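(* Let $b\ge 2$ be an integer. For $0\le\alpha\le\infty$ let $$S(\alpha)=\Big\{(x,y)\in(0,1]\times(0,1]:\ \lim_{n\to\infty}\frac{S_n(x,y)}{\log_b n}=\alpha\Big\},$$ where $S_n(x,y)$ is the length of the longest common substring with shifts of $x$ and $y$ in the first $n$ digits of their $b$-ary expansions. Then $$\dim_{\mathcal H}S(\alpha)=2\qquad\text{for every }\alpha\in[0,\infty].$$
   Context: Fix an integer $b\ge2$ and let $\mathcal A=\{0,1,\dots,b-1\}$. Every $x\in(0,1]$ has a unique non-terminating $b$-ary expansion $x=\sum_{i=1}^\infty x_i b^{-i}$ with $x_i\in\mathcal A$ (non-terminating: infinitely many $x_i$ are nonzero); $(x_1,x_2,\dots)$ is the digit sequence of $x$. Write $x_{i+1}^{i+l}=(x_{i+1},\dots,x_{i+l})$. For $(x,y)\in(0,1]^2$ and an integer $n\ge1$, $$S_n(x,y)=\max\{l\ge1:\ x_{i+1}^{i+l}=y_{j+1}^{j+l}\ \text{for some}\ 0\le i,j\le n-l\},$$ with $S_n(x,y)=0$ if no such $l$ exists. $\dim_{\mathcal H}$ denotes Hausdorff dimension, taken in $\mathbb R^2$ with the Euclidean metric. The limit being $\infty$ means divergence to $+\infty$. *)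

theory Defs
  imports "HOL-Analysis.Analysis"
begin

section \<open>Hausdorff dimension\<close>

text \<open>The cost \<open>(diam U)\<^sup>s\<close> of a covering set, with the usual conventions that the
  empty set costs \<open>0\<close> and that a nonempty set costs \<open>1\<close> when \<open>s = 0\<close>.  The case \<open>s = 0\<close>
  is separate because \<open>0 powr 0 = 0\<close>.\<close>

definition hausdorff_gauge :: "real \<Rightarrow> 'a::metric_space set \<Rightarrow> ennreal" where
  "hausdorff_gauge s U =
     (if U = {} then 0 else if s = 0 then 1 else ennreal (diameter U powr s))"

text \<open>Boundedness is required explicitly because \<^const>\<open>diameter\<close> is an unspecified
  real number on unbounded sets.  Finite covers are included, by padding with \<open>{}\<close>.\<close>

definition delta_covers :: "real \<Rightarrow> 'a::metric_space set \<Rightarrow> (nat \<Rightarrow> 'a set) set" where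
  "delta_covers \<delta> E =
     {U. E \<subseteq> (\<Union>k. U k) \<and> (\<forall>k. bounded (U k) \<and> diameter (U k) \<le> \<delta>)}"

definition hausdorff_premeasure :: "real \<Rightarrow> real \<Rightarrow> 'a::metric_space set \<Rightarrow> ennreal" where
  "hausdorff_premeasure s \<delta> E = (INF U\<in>delta_covers \<delta> E. \<Sum>k. hausdorff_gauge s (U k))"

definition hausdorff_measure :: "real \<Rightarrow> 'a::metric_space set \<Rightarrow> ennreal" where
  "hausdorff_measure s E = (SUP \<delta>\<in>{0<..}. hausdorff_premeasure s \<delta> E)"

definition hausdorff_dim :: "'a::metric_space set \<Rightarrow> ennreal" where
  "hausdorff_dim E = (INF s\<in>{s. 0 \<le> s \<and> hausdorff_measure s E = 0}. ennreal s)"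


section \<open>Longest common substrings of \<open>b\<close>-ary expansions\<close>

text \<open>Digit sequences are indexed from \<open>0\<close>: the digit \<open>x\<^sub>i\<close> with \<open>i \<ge> 1\<close> in mathematical
  notation is \<open>d (i - 1)\<close>.\<close>

definition nonterminating_expansion :: "nat \<Rightarrow> real \<Rightarrow> (nat \<Rightarrow> nat) \<Rightarrow> bool" where
  "nonterminating_expansion b x d \<longleftrightarrow>
     (\<forall>i. d i < b) \<and> infinite {i. d i \<noteq> 0} \<and>
     (\<lambda>i. real (d i) / real b ^ Suc i) sums x"

text \<open>Meaningful only for \<open>2 \<le> b\<close> and \<open>0 < x \<le> 1\<close>, where the expansion exists uniquely.\<close>

definition digits :: "nat \<Rightarrow> real \<Rightarrow> nat \<Rightarrow> nat" where
  "digits b x = (THE d. nonterminating_expansion b x d)"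

text \<open>With the index shift, the block \<open>(x\<^sub>i\<^sub>+\<^sub>1, \<dots>, x\<^sub>i\<^sub>+\<^sub>l)\<close> consists of the digits at positions
  \<open>i + k\<close> with \<open>k < l\<close>.  The condition \<open>i + l \<le> n\<close> expresses \<open>i \<le> n - l\<close> without
  truncated subtraction.\<close>

definition common_substring_lengths :: "nat \<Rightarrow> real \<Rightarrow> real \<Rightarrow> nat \<Rightarrow> nat set" where
  "common_substring_lengths b x y n =
     {l. 1 \<le> l \<and> (\<exists>i j. i + l \<le> n \<and> j + l \<le> n \<and>
           (\<forall>k<l. digits b x (i + k) = digits b y (j + k)))}"

definition longest_common_substring :: "nat \<Rightarrow> real \<Rightarrow> real \<Rightarrow> nat \<Rightarrow> nat" where
  "longest_common_substring b x y n =
     (if common_substring_lengths b x y n = {} then 0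
      else Max (common_substring_lengths b x y n))"

text \<open>The limit is taken in \<^typ>\<open>ereal\<close>, so \<open>\<alpha> = \<infinity>\<close> means divergence to \<open>+\<infinity>\<close>.\<close>

definition level_set :: "nat \<Rightarrow> ereal \<Rightarrow> (real \<times> real) set" where
  "level_set b \<alpha> =
     {(x, y). x \<in> {0<..1} \<and> y \<in> {0<..1} \<and>
        (\<lambda>n. ereal (real (longest_common_substring b x y n) / log (real b) (real n)))
          \<longlonglongrightarrow> \<alpha>}"

end

theory Submission
  imports Defs "HOL-Library.Discrete_Functions" "HOL-Real_Asymp.Real_Asymp"
begin

text \<open>
  The upper bound holds for every subset of the unit square.  For the lower bound, group the
  digits into blocks of length \<open>k\<^sup>2\<close> and call block \<open>q\<close> planted if it is among the first
  \<open>l s\<close> blocks from block \<open>s\<^sup>2\<close> on, where \<open>s = \<lfloor>\<surd>q\<rfloor>\<close>.  Fill planted blocks of both \<open>x\<close> and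
  \<open>y\<close> with ones; let every other block of \<open>x\<close> start with \<open>k\<close> zeros, and let \<open>y\<close> have a one
  at all multiples of \<open>k\<close>.  Then \<open>S\<^sub>n(x,y)\<close> is \<open>k\<^sup>2 l s\<close> with \<open>s\<close> about \<open>\<surd>(n/k\<^sup>2)\<close>, up to a
  bounded error, and a slowly growing \<open>l\<close> yields any limit \<open>\<alpha>\<close>.  The remaining digits are
  free, and their density \<open>\<gamma>\<close> tends to \<open>1\<close> as \<open>k\<close> grows.  Filling them with the digits of
  \<open>t \<in> [0,1)\<close> gives a map whose inverse is \<open>\<gamma>\<close>-Hoelder, because a fixed digit recurs every
  \<open>k\<close> places; pulling covers back to \<open>[0,1)\<^sup>2\<close> and comparing Lebesgue measures gives
  dimension at least \<open>2\<gamma>\<close>.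
\<close>

section \<open>Bounds for Hausdorff dimension in the plane\<close>

text \<open>A grid of \<open>N * N\<close> closed cells of side \<open>1 / N\<close> costs at most
  \<open>N^2 * (2 / N) powr s\<close>, which tends to 0 as \<open>N\<close> grows whenever
  \<open>s > 2\<close>.\<close>

lemma hausdorff_dim_unit_square_le:
  fixes E :: "(real \<times> real) set"
  assumes "E \<subseteq> {0..1} \<times> {0..1}"
  shows "hausdorff_dim E \<le> 2"
proof -
  have zero: "hausdorff_measure s E = 0" if s: "s > 2" for s
  proof -
    have "hausdorff_premeasure s \<delta> E \<le> 0" if \<delta>: "\<delta> > 0" for \<delta>
    proof (rule tendsto_lowerbound)
      show "((\<lambda>N. ennreal (real N ^ 2 * (2 / real N) powr s)) \<longlongrightarrow> 0) sequentially"
      proof -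
        have "((\<lambda>N. real N ^ 2 * (2 / real N) powr s) \<longlongrightarrow> 0) sequentially"
          using s by real_asymp
        then show ?thesis
          using tendsto_ennrealI by fastforce
      qed
      have "\<forall>\<^sub>F N in sequentially. 2 / real N \<le> \<delta>"
        using \<delta> by real_asymp
      with eventually_gt_at_top[of 0]
      show "\<forall>\<^sub>F N in sequentially. hausdorff_premeasure s \<delta> E
              \<le> ennreal (real N ^ 2 * (2 / real N) powr s)"
      proof eventually_elim
        case (elim N)
        define I where "I = (\<lambda>i::nat. {real i / real N .. (real i + 1) / real N})"
        \<comment> \<open>The index \<open>k\<close> encodes the cell in column
          \<open>k div N\<close> and row \<open>k mod N\<close>. The padding by empty sets costs
          nothing.\<close>
        define U where "U = (\<lambda>k. if k < N * N then I (k div N) \<times> I (k mod N) else {})"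
        have dist: "dist p q \<le> 2 / real N" if "p \<in> U k" "q \<in> U k" for p q k
        proof -
          have kN: "k < N * N" using that by (auto simp: U_def split: if_splits)
          then have "\<bar>fst p - fst q\<bar> \<le> 1 / real N" "\<bar>snd p - snd q\<bar> \<le> 1 / real N"
            using that by (auto simp: U_def I_def add_divide_distrib)
          moreover have "dist p q \<le> \<bar>fst p - fst q\<bar> + \<bar>snd p - snd q\<bar>"
            unfolding dist_prod_def dist_real_def
            using sqrt_sum_squares_le_sum_abs[of "\<bar>fst p - fst q\<bar>"] by simp
          ultimately show ?thesis by simp
        qed
        have bdd: "bounded (U k)" for k
          unfolding bounded_two_points using dist by blast
        have diam: "diameter (U k) \<le> 2 / real N" for k
          by (rule diameter_le) (use dist in \<open>auto simp: dist_norm\<close>)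
        have cov: "E \<subseteq> (\<Union>k. U k)"
        proof
          fix p assume "p \<in> E"
          then obtain x y where p: "p = (x, y)" and xy: "x \<in> {0..1}" "y \<in> {0..1}"
            using assms by (cases p) auto
          have idx: "\<exists>i<N. z \<in> I i" if z: "z \<in> {0..1}" for z
          proof (cases "z = 1")
            \<comment> \<open>The floor of \<open>N * z\<close> would be \<open>N\<close>, one too
              large, so the point 1 goes to the closed last interval.\<close>
            case True
            then show ?thesis using elim
              by (intro exI[of _ "N - 1"]) (auto simp: I_def field_simps of_nat_diff)
          next
            case False
            then have "real N * z < real N" "0 \<le> real N * z" using z elim by auto
            then have "nat \<lfloor>real N * z\<rfloor> < N" "real (nat \<lfloor>real N * z\<rfloor>) \<le> real N * z"
              "real N * z \<le> real (nat \<lfloor>real N * z\<rfloor>) + 1"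
              by (auto simp: nat_less_iff floor_less_iff)
            then show ?thesis using elim
              by (intro exI[of _ "nat \<lfloor>real N * z\<rfloor>"]) (auto simp: I_def field_simps)
          qed
          obtain i j where ij: "i < N" "j < N" "x \<in> I i" "y \<in> I j"
            using idx xy by blast
          have "i * N + j < Suc i * N" using ij by simp
          also have "\<dots> \<le> N * N" using ij by (intro mult_le_mono1) simp
          finally have "i * N + j < N * N" .
          then have "p \<in> U (i * N + j)"
            using ij elim p by (simp add: U_def)
          then show "p \<in> (\<Union>k. U k)" by blast
        qed
        have "U \<in> delta_covers \<delta> E"
          unfolding delta_covers_def using cov bdd diam elim by (auto intro: order_trans)
        then have "hausdorff_premeasure s \<delta> E \<le> (\<Sum>k. hausdorff_gauge s (U k))"
          unfolding hausdorff_premeasure_def by (rule INF_lower)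
        also have "\<dots> = (\<Sum>k<N * N. hausdorff_gauge s (U k))"
          by (rule suminf_finite) (auto simp: U_def hausdorff_gauge_def)
        also have "\<dots> \<le> (\<Sum>k<N * N. ennreal ((2 / real N) powr s))"
          using s diam by (intro sum_mono)
            (auto simp: hausdorff_gauge_def intro!: ennreal_leI powr_mono2 diameter_ge_0 bdd)
        also have "\<dots> = ennreal (real N ^ 2 * (2 / real N) powr s)"
          by (simp add: ennreal_mult ennreal_of_nat_eq_real_of_nat power2_eq_square)
        finally show ?case .
      qed
    qed auto
    then show ?thesis
      unfolding hausdorff_measure_def by (intro antisym SUP_least) auto
  qed
  show ?thesis
  proof (rule ennreal_le_epsilon)
    fix e :: real assume "e > 0"
    then have "hausdorff_dim E \<le> ennreal (2 + e)"
      unfolding hausdorff_dim_def by (intro INF_lower) (auto intro!: zero)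
    then show "hausdorff_dim E \<le> 2 + ennreal e"
      using \<open>e > 0\<close> by (simp add: ennreal_plus)
  qed
qed

text \<open>For \<open>s < 2 * \<gamma>\<close> the \<open>s\<close>-cost of a cover of
  \<open>E\<close> by sets of diameter at most 1 is bounded below: the preimage of a set of diameter
  \<open>d\<close> lies in a square of area \<open>4 * C^2 * d powr (2 * \<gamma>)\<close>, and
  these squares together must cover an area of 1.\<close>

lemma hausdorff_dim_ge_of_inverse_Hoelder:
  fixes \<phi> :: "real \<times> real \<Rightarrow> 'a::metric_space"
  assumes C: "C > 0" and \<gamma>: "\<gamma> > 0"
    and Hoelder: "\<And>p q. p \<in> {0..<1} \<times> {0..<1} \<Longrightarrow> q \<in> {0..<1} \<times> {0..<1} \<Longrightarrow>
      dist p q \<le> C * dist (\<phi> p) (\<phi> q) powr \<gamma>"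
    and sub: "\<phi> ` ({0..<1} \<times> {0..<1}) \<subseteq> E"
  shows "ennreal (2 * \<gamma>) \<le> hausdorff_dim E"
  unfolding hausdorff_dim_def
proof (rule INF_greatest, clarify)
  fix s assume s: "0 \<le> s" "hausdorff_measure s E = 0"
  show "ennreal (2 * \<gamma>) \<le> ennreal s"
  proof (rule ccontr)
    assume "\<not> ?thesis"
    then have s\<gamma>: "s < 2 * \<gamma>" using ennreal_leI by (meson not_le)
    define Q :: "(real \<times> real) set" where "Q = {0..<1} \<times> {0..<1}"
    have one: "1 \<le> ennreal (4 * C\<^sup>2) * (\<Sum>k. hausdorff_gauge s (U k))"
      if U: "U \<in> delta_covers 1 E" for U
    proof -
      have cov: "E \<subseteq> (\<Union>k. U k)" and bdd: "\<And>k. bounded (U k)"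
        and diam: "\<And>k. diameter (U k) \<le> 1"
        using U by (auto simp: delta_covers_def)
      \<comment> \<open>The preimage under \<open>\<phi>\<close> may fail to be measurable, so it is
        enclosed in a Borel set of controlled measure.\<close>
      have "\<exists>W. W \<in> sets lborel \<and> {p \<in> Q. \<phi> p \<in> U k} \<subseteq> W \<and>
              emeasure lborel W \<le> ennreal (4 * C\<^sup>2) * hausdorff_gauge s (U k)" for k
      proof (cases "{p \<in> Q. \<phi> p \<in> U k} = {}")
        case True
        then show ?thesis by (intro exI[of _ "{}"]) auto
      next
        case False
        then obtain p where p: "p \<in> Q" "\<phi> p \<in> U k" by blast
        define d where "d = diameter (U k)"
        define D where "D = C * d powr \<gamma>"
        have d: "0 \<le> d" "d \<le> 1" using diam bdd by (auto simp: d_def diameter_ge_0)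
        have D: "0 \<le> D" using C by (simp add: D_def)
        define W where "W = {fst p - D..fst p + D} \<times> {snd p - D..snd p + D}"
        have "q \<in> W" if q: "q \<in> Q" "\<phi> q \<in> U k" for q
        proof -
          have "dist (\<phi> p) (\<phi> q) \<le> d"
            unfolding d_def by (intro diameter_bounded_bound bdd p q)
          then have "C * dist (\<phi> p) (\<phi> q) powr \<gamma> \<le> D"
            unfolding D_def using C \<gamma> by (intro mult_left_mono powr_mono2) auto
          then have "dist p q \<le> D"
            using Hoelder[of p q] p q by (simp add: Q_def)
          then have "dist (fst p) (fst q) \<le> D" "dist (snd p) (snd q) \<le> D"
            using dist_fst_le[of p q] dist_snd_le[of p q] by linarith+
          then show ?thesis
            by (cases q) (auto simp: W_def dist_real_def)
        qed
        moreover have "emeasure lborel W = ennreal (4 * D\<^sup>2)"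
        proof -
          have "emeasure lborel W = emeasure (lborel \<Otimes>\<^sub>M lborel) W"
            by (simp add: lborel_prod)
          also have "\<dots> = emeasure lborel {fst p - D..fst p + D}
              * emeasure lborel {snd p - D..snd p + D}"
            unfolding W_def by (intro lborel.emeasure_pair_measure_Times) auto
          also have "\<dots> = ennreal (4 * D\<^sup>2)"
            using D by (simp add: ennreal_mult'[symmetric] power2_eq_square)
          finally show ?thesis .
        qed
        moreover have "ennreal (4 * D\<^sup>2) \<le> ennreal (4 * C\<^sup>2) * hausdorff_gauge s (U k)"
        proof -
          have sq: "D\<^sup>2 = C\<^sup>2 * d powr (2 * \<gamma>)"
            by (simp add: D_def power_mult_distrib power2_eq_square flip: powr_add)
          \<comment> \<open>Here \<open>d \<le> 1\<close> makes the smaller exponent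
            \<open>s\<close> give the larger power. For \<open>s = 0\<close> the gauge is 1 by
            convention.\<close>
          have "ennreal (d powr (2 * \<gamma>)) \<le> hausdorff_gauge s (U k)"
          proof (cases "s = 0")
            case True
            then show ?thesis using p d \<gamma>
              by (auto simp: hausdorff_gauge_def powr_le1)
          next
            case False
            then have "d powr (2 * \<gamma>) \<le> d powr s"
              using d s\<gamma> by (cases "d = 0") (auto intro!: powr_mono')
            then show ?thesis using p False
              by (auto simp: hausdorff_gauge_def d_def intro!: ennreal_leI)
          qed
          then have "ennreal (4 * C\<^sup>2) * ennreal (d powr (2 * \<gamma>))
              \<le> ennreal (4 * C\<^sup>2) * hausdorff_gauge s (U k)"
            by (rule mult_left_mono) auto
          then show ?thesis by (simp add: sq mult.assoc flip: ennreal_mult')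
        qed
        ultimately show ?thesis
          by (intro exI[of _ W]) (auto simp: W_def simp flip: borel_prod)
      qed
      then have "\<exists>W. \<forall>k. W k \<in> sets lborel \<and> {p \<in> Q. \<phi> p \<in> U k} \<subseteq> W k \<and>
          emeasure lborel (W k) \<le> ennreal (4 * C\<^sup>2) * hausdorff_gauge s (U k)"
        by (intro choice allI)
      then obtain W where W: "\<And>k. W k \<in> sets lborel"
        "\<And>k. {p \<in> Q. \<phi> p \<in> U k} \<subseteq> W k"
        "\<And>k. emeasure lborel (W k) \<le> ennreal (4 * C\<^sup>2) * hausdorff_gauge s (U k)"
        by auto
      have "Q \<subseteq> (\<Union>k. W k)"
      proof
        fix p assume "p \<in> Q"
        then have "\<phi> p \<in> (\<Union>k. U k)" using sub cov by (auto simp: Q_def)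
        then show "p \<in> (\<Union>k. W k)" using W(2) \<open>p \<in> Q\<close> by blast
      qed
      have "1 = emeasure lborel {0..<1::real} * emeasure lborel {0..<1::real}" by simp
      also have "\<dots> = emeasure (lborel \<Otimes>\<^sub>M lborel) Q"
        unfolding Q_def by (intro lborel.emeasure_pair_measure_Times[symmetric]) auto
      also have "\<dots> = emeasure lborel Q"
        by (simp add: lborel_prod)
      also have "\<dots> \<le> emeasure lborel (\<Union>k. W k)"
        using W(1) \<open>Q \<subseteq> _\<close> by (intro emeasure_mono) auto
      also have "\<dots> \<le> (\<Sum>k. emeasure lborel (W k))"
        using W(1) by (intro emeasure_subadditive_countably) auto
      also have "\<dots> \<le> (\<Sum>k. ennreal (4 * C\<^sup>2) * hausdorff_gauge s (U k))"
        using W(3) by (intro suminf_le) auto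
      also have "\<dots> = ennreal (4 * C\<^sup>2) * (\<Sum>k. hausdorff_gauge s (U k))"
        by simp
      finally show ?thesis .
    qed
    have "ennreal (1 / (4 * C\<^sup>2)) \<le> hausdorff_premeasure s 1 E"
      unfolding hausdorff_premeasure_def
    proof (rule INF_greatest)
      fix U assume "U \<in> delta_covers 1 E"
      from mult_left_mono[OF one[OF this], of "ennreal (1 / (4 * C\<^sup>2))"]
      show "ennreal (1 / (4 * C\<^sup>2)) \<le> (\<Sum>k. hausdorff_gauge s (U k))"
        using C by (simp add: mult.assoc[symmetric] flip: ennreal_mult')
    qed
    also have "\<dots> \<le> hausdorff_measure s E"
      unfolding hausdorff_measure_def by (intro SUP_upper) auto
    finally show False using s C by simp
  qed
qed

section \<open>Expansions with prescribed digits\<close>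

definition expansion_value :: "nat \<Rightarrow> (nat \<Rightarrow> nat) \<Rightarrow> real" where
  "expansion_value b d = (\<Sum>i. real (d i) / real b ^ Suc i)"

lemma expansion_sums:
  assumes "2 \<le> b" "\<And>i. d i < b"
  shows "(\<lambda>i. real (d i) / real b ^ Suc i) sums expansion_value b d"
proof -
  have "summable (\<lambda>i. (1 / real b) ^ i)"
    using assms by (intro summable_geometric) auto
  then have "summable (\<lambda>i. real (d i) / real b ^ Suc i)"
  proof (rule summable_comparison_test'[where N = 0])
    fix i
    have "real (d i) \<le> real b" using assms(2)[of i] by simp
    then show "norm (real (d i) / real b ^ Suc i) \<le> (1 / real b) ^ i"
      using assms(1) by (simp add: field_simps)
  qed
  then show ?thesis unfolding expansion_value_def by (rule summable_sums)
qed

text \<open>If all digits after the first difference \<open>i\<close> carried maximally, the two values could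
  coincide; the position \<open>f\<close>, where the carry is not maximal, keeps them apart.\<close>

lemma expansion_value_gap:
  assumes b: "2 \<le> b" and d: "\<And>j. d j < b" and e: "\<And>j. e j < b"
    and agree: "\<And>j. j < i \<Longrightarrow> d j = e j" and less: "d i < e i"
    and f: "i < f" "d f + 2 \<le> e f + b"
  shows "expansion_value b d + 1 / real b ^ Suc f \<le> expansion_value b e"
proof -
  \<comment> \<open>The increments of \<open>T\<close> are the extreme contributions after a first
    difference at \<open>i\<close>: a digit gain of 1 at \<open>i\<close> and a loss of
    \<open>b - 1\<close> at every later place. They telescope to 0. In \<open>g\<close> the loss at
    \<open>f\<close> is one unit smaller, so its sum is exactly the claimed gap.\<close>
  define T where "T = (\<lambda>j. if j \<le> i then 0 else 1 / real b ^ j)"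
  define g where "g = (\<lambda>j. (T (Suc j) - T j) + (if j = f then 1 / real b ^ Suc f else 0))"
  have "T \<longlonglongrightarrow> 0"
  proof (rule Lim_transform_eventually)
    show "(\<lambda>j. (1 / real b) ^ j) \<longlonglongrightarrow> 0" using b by (intro LIMSEQ_power_zero) auto
    show "\<forall>\<^sub>F j in sequentially. (1 / real b) ^ j = T j"
      using eventually_gt_at_top[of i] by eventually_elim (simp add: T_def power_one_over)
  qed
  then have "(\<lambda>j. T (Suc j) - T j) sums (0 - T 0)" by (rule telescope_sums)
  then have "g sums (0 - T 0 + 1 / real b ^ Suc f)"
    unfolding g_def by (rule sums_add) (rule sums_single[of f "\<lambda>_. 1 / real b ^ Suc f"])
  then have g: "g sums (1 / real b ^ Suc f)" by (simp add: T_def)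
  have w: "(\<lambda>j. real (e j) / real b ^ Suc j - real (d j) / real b ^ Suc j)
      sums (expansion_value b e - expansion_value b d)"
    by (intro sums_diff expansion_sums assms)
  have "g j \<le> real (e j) / real b ^ Suc j - real (d j) / real b ^ Suc j" for j
  proof -
    consider "j < i" | "j = i" | "i < j" "j \<noteq> f" | "j = f" by linarith
    then show ?thesis
    proof cases
      case 1
      then show ?thesis using f agree[of j] by (simp add: g_def T_def)
    next
      case 2
      have "1 \<le> real (e i) - real (d i)" using less by linarith
      then have "1 / real b ^ Suc i \<le> (real (e i) - real (d i)) / real b ^ Suc i"
        by (intro divide_right_mono) auto
      then show ?thesis using 2 f by (simp add: g_def T_def diff_divide_distrib)
    next
      case 3
      have "1 - real b \<le> real (e j) - real (d j)" using d[of j] by linarith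
      then have "(1 - real b) / real b ^ Suc j \<le> (real (e j) - real (d j)) / real b ^ Suc j"
        by (intro divide_right_mono) auto
      moreover have "g j = (1 - real b) / real b ^ Suc j"
        using 3 b by (simp add: g_def T_def field_simps)
      ultimately show ?thesis by (simp add: diff_divide_distrib)
    next
      case 4
      have "2 - real b \<le> real (e f) - real (d f)" using f by linarith
      then have "(2 - real b) / real b ^ Suc f \<le> (real (e f) - real (d f)) / real b ^ Suc f"
        by (intro divide_right_mono) auto
      moreover have "g f = (2 - real b) / real b ^ Suc f"
        using f b by (simp add: g_def T_def field_simps)
      ultimately show ?thesis using 4 by (simp add: diff_divide_distrib)
    qed
  qed
  then have "1 / real b ^ Suc f \<le> expansion_value b e - expansion_value b d"
    by (rule sums_le[OF _ g w])
  then show ?thesis by simp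
qed

lemma exists_first_difference:
  fixes d e :: "nat \<Rightarrow> 'a"
  assumes "d \<noteq> e"
  obtains i where "d i \<noteq> e i" "\<And>j. j < i \<Longrightarrow> d j = e j"
proof -
  from assms obtain i where "d i \<noteq> e i" by blast
  then show ?thesis
    using that[of "LEAST i. d i \<noteq> e i"] LeastI[of "\<lambda>i. d i \<noteq> e i" i] not_less_Least by blast
qed

text \<open>Since \<open>e\<close> does not terminate, it has a nonzero digit at some
  \<open>f\<close> beyond \<open>i\<close>. As \<open>d f\<close> is at most \<open>b - 1\<close>,
  the carry at \<open>f\<close> is not maximal and \<open>expansion_value_gap\<close>
  applies.\<close>

lemma nonterminating_expansion_less:
  assumes b: "2 \<le> b"
    and d: "nonterminating_expansion b x d" and e: "nonterminating_expansion b y e"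
    and agree: "\<And>j. j < i \<Longrightarrow> d j = e j" and less: "d i < e i"
  shows "x < y"
proof -
  have db: "\<And>j. d j < b" and eb: "\<And>j. e j < b" and inf: "infinite {j. e j \<noteq> 0}"
    using d e by (auto simp: nonterminating_expansion_def)
  have xy: "x = expansion_value b d" "y = expansion_value b e"
    using d e expansion_sums[OF b db] expansion_sums[OF b eb]
    by (auto simp: nonterminating_expansion_def intro: sums_unique2)
  obtain f where f: "i < f" "e f \<noteq> 0"
    using inf unfolding infinite_nat_iff_unbounded by blast
  then have "d f + 2 \<le> e f + b" using db[of f] by simp
  from expansion_value_gap[OF b db eb agree less f(1) this]
  have "x + 1 / real b ^ Suc f \<le> y" by (simp add: xy)
  moreover have "0 < 1 / real b ^ Suc f" using b by simp
  ultimately show ?thesis by linarith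
qed

lemma digits_expansion_value:
  assumes b: "2 \<le> b" and d: "\<And>i. d i < b" and inf: "infinite {i. d i \<noteq> 0}"
  shows "digits b (expansion_value b d) = d"
proof -
  have nt: "nonterminating_expansion b (expansion_value b d) d"
    using assms expansion_sums[OF b d] by (simp add: nonterminating_expansion_def)
  have "e = d" if e: "nonterminating_expansion b (expansion_value b d) e" for e
  proof (rule ccontr)
    assume "e \<noteq> d"
    then obtain i where i: "e i \<noteq> d i" "\<And>j. j < i \<Longrightarrow> e j = d j"
      by (rule exists_first_difference) blast
    consider "e i < d i" | "d i < e i" using i(1) by linarith
    then show False
      using nonterminating_expansion_less[OF b e nt] nonterminating_expansion_less[OF b nt e] i(2)
      by cases fastforce+
  qed
  with nt show ?thesis unfolding digits_def by (rule the_equality)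
qed

lemma expansion_value_in_unit_interval:
  assumes b: "2 \<le> b" and d: "\<And>i. d i < b" and inf: "infinite {i. d i \<noteq> 0}"
  shows "expansion_value b d \<in> {0<..1}"
proof -
  have s: "summable (\<lambda>i. real (d i) / real b ^ Suc i)"
    using expansion_sums[OF b d] by (rule sums_summable)
  obtain i where "d i \<noteq> 0" using inf by (metis (mono_tags, lifting) empty_Collect_eq finite.emptyI)
  then have pos: "0 < expansion_value b d"
    unfolding expansion_value_def using b by (intro suminf_pos2[OF s, of i]) auto
  have g: "(\<lambda>i. (real b - 1) / real b * (1 / real b) ^ i) sums
      ((real b - 1) / real b * (1 / (1 - 1 / real b)))"
    using b by (intro sums_mult geometric_sums) auto
  have "real (d i) / real b ^ Suc i \<le> (real b - 1) / real b * (1 / real b) ^ i" for i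
    using d[of i] b by (simp add: field_simps)
  then have "expansion_value b d \<le> (real b - 1) / real b * (1 / (1 - 1 / real b))"
    by (rule sums_le[OF _ expansion_sums[OF b d] g])
  also have "\<dots> = 1" using b by (simp add: field_simps)
  finally show ?thesis using pos by simp
qed

text \<open>Unlike \<^const>\<open>digits\<close>, this is the terminating choice of digits, valid on \<open>[0,1)\<close>.\<close>

definition floor_digit :: "nat \<Rightarrow> real \<Rightarrow> nat \<Rightarrow> nat" where
  "floor_digit b t i = nat (\<lfloor>real b ^ Suc i * t\<rfloor> mod int b)"

lemma floor_digit_less: "2 \<le> b \<Longrightarrow> floor_digit b t i < b"
  by (simp add: floor_digit_def nat_less_iff)

text \<open>The first \<open>m\<close> digits determine the integer part of \<open>b^m * t\<close>
  by Horner's recursion, which starts from 0 because \<open>t < 1\<close>. Numbers with equal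
  integer parts differ by at most 1.\<close>

lemma abs_diff_le_if_floor_digits_agree:
  assumes b: "2 \<le> b" and t: "t \<in> {0..<1}" "t' \<in> {0..<1}"
    and agree: "\<And>i. i < m \<Longrightarrow> floor_digit b t i = floor_digit b t' i"
  shows "\<bar>t - t'\<bar> \<le> 1 / real b ^ m"
proof -
  have "\<lfloor>real b ^ m * t\<rfloor> = \<lfloor>real b ^ m * t'\<rfloor>"
    using agree
  proof (induction m)
    case 0
    have "\<lfloor>t\<rfloor> = 0" "\<lfloor>t'\<rfloor> = 0" using t by (simp_all add: floor_eq_iff)
    then show ?case by simp
  next
    case (Suc m)
    have step: "\<lfloor>real b ^ Suc m * s\<rfloor> = int b * \<lfloor>real b ^ m * s\<rfloor> + int (floor_digit b s m)" for s
    proof -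
      have "\<lfloor>real b ^ m * s\<rfloor> = \<lfloor>real b ^ Suc m * s / real_of_int (int b)\<rfloor>"
        using b by simp
      also have "\<dots> = \<lfloor>real b ^ Suc m * s\<rfloor> div int b"
        by (rule floor_divide_real_eq_div) simp
      finally show ?thesis using b by (simp add: floor_digit_def)
    qed
    show ?case unfolding step using Suc by simp
  qed
  then have "\<bar>real b ^ m * t - real b ^ m * t'\<bar> \<le> 1" by linarith
  then have "real b ^ m * \<bar>t - t'\<bar> \<le> 1"
    using b by (simp add: abs_mult flip: right_diff_distrib)
  then show ?thesis using b by (simp add: field_simps)
qed

text \<open>The cardinality is the rank of \<open>i\<close> among the free positions, so these carry
  the digits of \<open>t\<close> in order, without gaps or repetitions.\<close>

definition fill :: "nat \<Rightarrow> nat set \<Rightarrow> (nat \<Rightarrow> nat) \<Rightarrow> real \<Rightarrow> nat \<Rightarrow> nat" where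
  "fill b F u t i = (if i \<in> F then u i else floor_digit b t (card {j. j < i \<and> j \<notin> F}))"

lemma fill_less: "2 \<le> b \<Longrightarrow> (\<And>i. u i < b) \<Longrightarrow> fill b F u t i < b"
  by (simp add: fill_def floor_digit_less)

lemma card_Collect_less_Suc:
  "card {j. j < Suc n \<and> P j} = card {j. j < n \<and> P j} + (if P n then 1 else 0)"
proof -
  have "{j. j < Suc n \<and> P j} = (if P n then insert n {j. j < n \<and> P j} else {j. j < n \<and> P j})"
    by (auto simp: less_Suc_eq)
  then show ?thesis by simp
qed

lemma floor_digits_agree_if_fill_agree:
  assumes "\<And>i. i < n \<Longrightarrow> fill b F u t i = fill b F u t' i" "m < card {j. j < n \<and> j \<notin> F}"
  shows "floor_digit b t m = floor_digit b t' m"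
  using assms
proof (induction n)
  case (Suc n)
  show ?case
  proof (cases "m < card {j. j < n \<and> j \<notin> F}")
    \<comment> \<open>The count of free positions passes \<open>m\<close> exactly at
      \<open>n\<close>, so digit \<open>m\<close> of the parameter is stored there.\<close>
    case False
    then have "n \<notin> F" "m = card {j. j < n \<and> j \<notin> F}"
      using Suc.prems(2) by (auto simp: card_Collect_less_Suc split: if_splits)
    then show ?thesis using Suc.prems(1)[of n] by (simp add: fill_def)
  qed (use Suc in auto)
qed simp

text \<open>If the filled sequences first differ at \<open>i\<close>, the parameters share about
  \<open>\<gamma> * i\<close> digits. A fixed position at most \<open>k\<close> places later carries
  the same digit in both, so the values are at least \<open>b powr -(i + k + 1)\<close> apart. The
  delay \<open>k + 1\<close> goes into the constant.\<close>

lemma fill_inverse_Hoelder: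
  assumes b: "2 \<le> b" and u: "\<And>i. u i < b" and k: "k > 0"
    and fixed: "\<And>i. k dvd i \<Longrightarrow> i \<in> F"
    and \<gamma>: "0 < \<gamma>"
    and dense: "\<And>n. \<gamma> * real n - C \<le> real (card {j. j < n \<and> j \<notin> F})"
    and t: "t \<in> {0..<1}" "t' \<in> {0..<1}"
  shows "\<bar>t - t'\<bar> \<le> real b powr (C + \<gamma> * (real k + 1)) *
    \<bar>expansion_value b (fill b F u t) - expansion_value b (fill b F u t')\<bar> powr \<gamma>"
proof -
  let ?d = "fill b F u t" and ?e = "fill b F u t'"
  have close: "\<bar>t - t'\<bar> \<le> real b powr (C - \<gamma> * real n)" if "\<And>i. i < n \<Longrightarrow> ?d i = ?e i" for n
  proof -
    have "\<bar>t - t'\<bar> \<le> 1 / real b ^ card {j. j < n \<and> j \<notin> F}"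
      using that
      by (intro abs_diff_le_if_floor_digits_agree b t floor_digits_agree_if_fill_agree) auto
    also have "\<dots> = real b powr (- real (card {j. j < n \<and> j \<notin> F}))"
      using b by (simp add: powr_minus powr_realpow field_simps)
    also have "\<dots> \<le> real b powr (C - \<gamma> * real n)"
      using b dense[of n] by (intro powr_mono) auto
    finally show ?thesis .
  qed
  show ?thesis
  proof (cases "?d = ?e")
    \<comment> \<open>Agreement at every position forces equal parameters, so the left-hand side is
      0.\<close>
    case True
    have "(\<lambda>n. real b powr (C - \<gamma> * real n)) \<longlonglongrightarrow> 0"
      using b \<gamma> by real_asymp
    then have "\<bar>t - t'\<bar> \<le> 0"
      using close True by (intro tendsto_lowerbound) (auto intro!: always_eventually)
    then show ?thesis by simp
  next
    case False
    then obtain i where i: "?d i \<noteq> ?e i" "\<And>j. j < i \<Longrightarrow> ?d j = ?e j"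
      by (rule exists_first_difference) blast
    \<comment> \<open>This is the least multiple of \<open>k\<close> above \<open>i\<close>. Equal
      digits at \<open>f\<close> satisfy the carry condition of \<open>expansion_value_gap\<close>
      because \<open>b \<ge> 2\<close>.\<close>
    define f where "f = k * (i div k) + k"
    have f: "i < f" "f \<le> i + k"
      using k dividend_less_times_div[of k i] by (simp_all add: f_def)
    have "f \<in> F" by (intro fixed) (simp add: f_def)
    then have same: "?d f = ?e f" by (simp add: fill_def)
    have "1 / real b ^ Suc f \<le> \<bar>expansion_value b ?d - expansion_value b ?e\<bar>"
    proof (cases "?d i < ?e i")
      case True
      then show ?thesis
        using expansion_value_gap[of b ?d ?e i f] b i f same fill_less[OF b u] by fastforce
    next
      case False
      then show ?thesis
        using expansion_value_gap[of b ?e ?d i f] b i f same fill_less[OF b u] by fastforce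
    qed
    moreover have "real b powr (- (real i + real k + 1)) \<le> 1 / real b ^ Suc f"
    proof -
      have "real b powr (- (real i + real k + 1)) \<le> real b powr (- real (Suc f))"
        using b f by (intro powr_mono) auto
      then show ?thesis using b by (simp only: powr_minus powr_realpow) (simp add: field_simps)
    qed
    ultimately have gap: "real b powr (- (real i + real k + 1))
        \<le> \<bar>expansion_value b ?d - expansion_value b ?e\<bar>" by linarith
    have "\<bar>t - t'\<bar> \<le> real b powr (C - \<gamma> * real i)" using i(2) by (rule close)
    also have "\<dots> = real b powr (C + \<gamma> * (real k + 1)) * (real b powr (- (real i + real k + 1))) powr \<gamma>"
      by (simp add: powr_powr algebra_simps flip: powr_add)
    also have "\<dots> \<le> real b powr (C + \<gamma> * (real k + 1)) *
        \<bar>expansion_value b ?d - expansion_value b ?e\<bar> powr \<gamma>"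
      using gap \<gamma> by (intro mult_left_mono powr_mono2) auto
    finally show ?thesis .
  qed
qed

section \<open>Planted blocks\<close>

definition planted :: "(nat \<Rightarrow> nat) \<Rightarrow> nat \<Rightarrow> bool" where
  "planted l q \<longleftrightarrow> q < (floor_sqrt q)\<^sup>2 + l (floor_sqrt q)"

text \<open>The last block before the next square is not planted, so a run never crosses a square
  and lies within the first \<open>l s\<close> blocks after \<open>s^2\<close>. The bound uses the
  root of the last block so that monotonicity of \<open>l\<close> can compare it with the root
  belonging to \<open>n\<close>.\<close>

lemma planted_run_bound:
  assumes l: "\<And>j. (l j)\<^sup>2 \<le> j" and run: "\<And>t. t \<le> m \<Longrightarrow> planted l (q + t)"
  shows "m < l (floor_sqrt (q + m))"
proof -
  define s where "s = floor_sqrt q"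
  define e where "e = s\<^sup>2 + 2 * s"
  have q: "s\<^sup>2 \<le> q" "q \<le> e"
    using floor_sqrt_power2_le[of q] Suc_floor_sqrt_power2_gt[of q]
    by (simp_all add: s_def e_def power2_eq_square)
  have "floor_sqrt e = s"
    by (rule floor_sqrt_unique) (simp_all add: e_def power2_eq_square)
  moreover have "l s \<le> s"
    using l[of s] by (rule power2_nat_le_imp_le)
  ultimately have "\<not> planted l e" by (simp add: planted_def e_def)
  then have "\<not> e - q \<le> m" using run[of "e - q"] q by auto
  then have "q + m < e" by simp
  then have "floor_sqrt (q + m) = s"
    using q by (intro floor_sqrt_unique) (simp_all add: e_def power2_eq_square)
  then show ?thesis using run[of m] q by (simp add: planted_def)
qed

text \<open>The blocks from \<open>j^2\<close> up to the next square include at most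
  \<open>l j\<close> planted ones, and monotonicity replaces each \<open>l j\<close> by
  \<open>l s\<close>.\<close>

lemma card_planted_below_square_le:
  assumes "mono l"
  shows "card {q. q < s\<^sup>2 \<and> planted l q} \<le> s * l s"
proof (induction s)
  case (Suc s)
  have "{q. q < (Suc s)\<^sup>2 \<and> planted l q}
      \<subseteq> {q. q < s\<^sup>2 \<and> planted l q} \<union> {s\<^sup>2..<s\<^sup>2 + l s}"
  proof
    fix q assume q: "q \<in> {q. q < (Suc s)\<^sup>2 \<and> planted l q}"
    show "q \<in> {q. q < s\<^sup>2 \<and> planted l q} \<union> {s\<^sup>2..<s\<^sup>2 + l s}"
    proof (cases "q < s\<^sup>2")
      case False
      then have "floor_sqrt q = s" using q by (intro floor_sqrt_unique) auto
      then show ?thesis using q False by (simp add: planted_def)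
    qed (use q in simp)
  qed
  then have "card {q. q < (Suc s)\<^sup>2 \<and> planted l q}
      \<le> card ({q. q < s\<^sup>2 \<and> planted l q} \<union> {s\<^sup>2..<s\<^sup>2 + l s})"
    by (intro card_mono) auto
  also have "\<dots> \<le> card {q. q < s\<^sup>2 \<and> planted l q} + l s"
    using card_Un_le[of "{q. q < s\<^sup>2 \<and> planted l q}" "{s\<^sup>2..<s\<^sup>2 + l s}"] by simp
  also have "\<dots> \<le> s * l s + l s" using Suc by simp
  also have "\<dots> = Suc s * l s" by simp
  also have "\<dots> \<le> Suc s * l (Suc s)" using assms by (intro mult_left_mono) (auto simp: mono_def)
  finally show ?case .
qed simp

lemma floor_sqrt_bounds:
  "real (floor_sqrt n) \<le> sqrt (real n)" "sqrt (real n) < real (floor_sqrt n) + 1"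
proof -
  have "real ((floor_sqrt n)\<^sup>2) \<le> real n" using floor_sqrt_power2_le by (intro of_nat_mono)
  then show "real (floor_sqrt n) \<le> sqrt (real n)" by (simp add: real_le_rsqrt)
  have "real n < real ((Suc (floor_sqrt n))\<^sup>2)"
    using Suc_floor_sqrt_power2_gt by (intro iffD2[OF of_nat_less_iff])
  then have "sqrt (real n) < real (Suc (floor_sqrt n))"
    by (intro real_less_lsqrt) auto
  then show "sqrt (real n) < real (floor_sqrt n) + 1" by simp
qed

text \<open>With \<open>s\<close> about the root of \<open>n\<close> and \<open>l s\<close> at most
  the root of \<open>s\<close>, the count is of order \<open>n^(3/4)\<close>. The constant absorbs
  the finitely many small \<open>n\<close>.\<close>

lemma planted_sparse:
  assumes l: "mono l" "\<And>j. (l j)\<^sup>2 \<le> j" and \<delta>: "\<delta> > 0"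
  obtains C where "\<And>n. real (card {q. q < n \<and> planted l q}) \<le> \<delta> * real n + C"
proof -
  have "\<forall>\<^sub>F n in sequentially. (sqrt (real n) + 1) * sqrt (sqrt (real n) + 1) \<le> \<delta> * real n"
    using \<delta> by real_asymp
  then obtain N where N: "\<And>n. n \<ge> N \<Longrightarrow>
      (sqrt (real n) + 1) * sqrt (sqrt (real n) + 1) \<le> \<delta> * real n"
    by (auto simp: eventually_at_top_linorder)
  have "real (card {q. q < n \<and> planted l q}) \<le> \<delta> * real n + real N" for n
  proof (cases "n \<ge> N")
    case True
    define s where "s = Suc (floor_sqrt n)"
    have s: "real s \<le> sqrt (real n) + 1" using floor_sqrt_bounds[of n] by (simp add: s_def)
    have ls: "real (l s) \<le> sqrt (real s)"
      using l(2)[of s] by (intro real_le_rsqrt) (metis of_nat_le_iff of_nat_power)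
    have "n < s\<^sup>2" using Suc_floor_sqrt_power2_gt[of n] by (simp add: s_def)
    then have "card {q. q < n \<and> planted l q} \<le> card {q. q < s\<^sup>2 \<and> planted l q}"
      by (intro card_mono) auto
    also have "\<dots> \<le> s * l s" by (rule card_planted_below_square_le[OF l(1)])
    finally have "real (card {q. q < n \<and> planted l q}) \<le> real s * real (l s)"
      by (metis of_nat_le_iff of_nat_mult)
    also have "\<dots> \<le> (sqrt (real n) + 1) * sqrt (sqrt (real n) + 1)"
      using s ls by (intro mult_mono) (auto intro: order_trans)
    finally show ?thesis using N[OF True] by simp
  next
    case False
    have "card {q. q < n \<and> planted l q} \<le> card {..<n}" by (intro card_mono) auto
    with False have "real (card {q. q < n \<and> planted l q}) \<le> real N" by simp
    then show ?thesis using \<delta> by (simp add: add_increasing)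
  qed
  then show ?thesis by (rule that)
qed

text \<open>One set serves both coordinates, so a single density estimate covers them. Planted
  blocks create long matches, multiples of \<open>k\<close> hold the ones of \<open>y\<close> and
  the recurring fixed digits of the Hoelder estimate, and the initial \<open>k\<close> places of a
  block hold the zeros of \<open>x\<close>.\<close>

definition fixed_positions :: "(nat \<Rightarrow> nat) \<Rightarrow> nat \<Rightarrow> nat set" where
  "fixed_positions l k = {i. planted l (i div k\<^sup>2) \<or> k dvd i \<or> i mod k\<^sup>2 < k}"

text \<open>A planted block has \<open>k^2\<close> fixed positions. An unplanted one has at most
  \<open>2 * k\<close>: its first \<open>k\<close> places and its \<open>k\<close> multiples of
  \<open>k\<close>.\<close>

lemma card_fixed_positions_le:
  assumes k: "k > 0"
  shows "card {i. i < Q * k\<^sup>2 \<and> i \<in> fixed_positions l k}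
    \<le> k\<^sup>2 * card {q. q < Q \<and> planted l q} + 2 * k * Q"
proof (induction Q)
  case (Suc Q)
  define B where "B = {i. Q * k\<^sup>2 \<le> i \<and> i < Suc Q * k\<^sup>2 \<and> i \<in> fixed_positions l k}"
  have "{i. i < Suc Q * k\<^sup>2 \<and> i \<in> fixed_positions l k}
      = {i. i < Q * k\<^sup>2 \<and> i \<in> fixed_positions l k} \<union> B"
    by (auto simp: B_def)
  then have step: "card {i. i < Suc Q * k\<^sup>2 \<and> i \<in> fixed_positions l k}
      \<le> card {i. i < Q * k\<^sup>2 \<and> i \<in> fixed_positions l k} + card B"
    by (simp add: card_Un_le)
  have B: "card B \<le> k\<^sup>2 * (if planted l Q then 1 else 0) + 2 * k"
  proof (cases "planted l Q")
    case True
    have "card B \<le> card {Q * k\<^sup>2..<Suc Q * k\<^sup>2}" by (intro card_mono) (auto simp: B_def)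
    then show ?thesis using True by simp
  next
    case False
    have "B \<subseteq> (\<lambda>t. Q * k\<^sup>2 + t) ` {..<k} \<union> (\<lambda>t. Q * k\<^sup>2 + k * t) ` {..<k}"
    proof
      fix i assume i: "i \<in> B"
      define r where "r = i - Q * k\<^sup>2"
      have ir: "i = Q * k\<^sup>2 + r" "r < k\<^sup>2" using i by (auto simp: B_def r_def)
      then have "i div k\<^sup>2 = Q" "i mod k\<^sup>2 = r" using k by simp_all
      then have "k dvd i \<or> r < k" using i False by (auto simp: B_def fixed_positions_def)
      then show "i \<in> (\<lambda>t. Q * k\<^sup>2 + t) ` {..<k} \<union> (\<lambda>t. Q * k\<^sup>2 + k * t) ` {..<k}"
      proof
        assume "k dvd i"
        then have "k dvd r" using ir by (simp add: dvd_add_right_iff power2_eq_square)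
        then obtain t where "r = k * t" by blast
        then show ?thesis using ir k by (auto simp: power2_eq_square)
      qed (use ir in auto)
    qed
    then have "card B \<le> card ((\<lambda>t. Q * k\<^sup>2 + t) ` {..<k} \<union> (\<lambda>t. Q * k\<^sup>2 + k * t) ` {..<k})"
      by (intro card_mono) auto
    also have "\<dots> \<le> card ((\<lambda>t. Q * k\<^sup>2 + t) ` {..<k}) + card ((\<lambda>t. Q * k\<^sup>2 + k * t) ` {..<k})"
      by (rule card_Un_le)
    also have "\<dots> \<le> k + k"
      using card_image_le[of "{..<k}" "\<lambda>t. Q * k\<^sup>2 + t"]
        card_image_le[of "{..<k}" "\<lambda>t. Q * k\<^sup>2 + k * t"]
      by (intro add_mono) simp_all
    finally show ?thesis using False by simp
  qed
  show ?case
    using order_trans[OF step add_mono[OF Suc B]]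
    by (simp add: card_Collect_less_Suc algebra_simps split: if_splits)
qed simp

lemma free_positions_dense:
  assumes l: "mono l" "\<And>j. (l j)\<^sup>2 \<le> j" and \<gamma>: "\<gamma> < 1" and k: "real k \<ge> 4 / (1 - \<gamma>)"
  obtains C where
    "\<And>n. \<gamma> * real n - C \<le> real (card {i. i < n \<and> i \<notin> fixed_positions l k})"
proof -
  \<comment> \<open>The allowed loss \<open>1 - \<gamma>\<close> is split evenly: one
    \<open>\<delta>\<close> for the planted blocks and one for the proportion \<open>2 / k\<close>
    fixed elsewhere, which the lower bound on \<open>k\<close> keeps below
    \<open>\<delta>\<close>.\<close>
  define \<delta> where "\<delta> = (1 - \<gamma>) / 2"
  have \<delta>: "\<delta> > 0" using \<gamma> by (simp add: \<delta>_def)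
  have k0: "real k > 0" using \<gamma> k by (smt (verit) divide_pos_pos)
  have k\<delta>: "2 \<le> \<delta> * real k" using k \<gamma> by (simp add: \<delta>_def field_simps)
  obtain C where C: "\<And>n. real (card {q. q < n \<and> planted l q}) \<le> \<delta> * real n + C"
    using planted_sparse[OF l \<delta>] by blast
  define K where "K = real k ^ 2"
  have K: "K > 0" using k0 by (simp add: K_def)
  have "\<gamma> * real n - (2 * \<delta> * K + K * C)
      \<le> real (card {i. i < n \<and> i \<notin> fixed_positions l k})" for n
  proof -
    \<comment> \<open>Rounding up to whole blocks adds at most \<open>K\<close> positions, which
      only changes the additive constant.\<close>
    define Q where "Q = Suc (n div k\<^sup>2)"
    have nQ: "n \<le> Q * k\<^sup>2"
      using dividend_less_div_times[of "k\<^sup>2" n] k0 by (simp add: Q_def)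
    have "(n div k\<^sup>2) * k\<^sup>2 \<le> n" by simp
    then have "real (n div k\<^sup>2) * K \<le> real n"
      unfolding K_def by (metis of_nat_le_iff of_nat_mult of_nat_power)
    then have QK: "real Q * K \<le> real n + K" by (simp add: Q_def algebra_simps)
    have "card {i. i < n \<and> i \<in> fixed_positions l k}
        \<le> card {i. i < Q * k\<^sup>2 \<and> i \<in> fixed_positions l k}"
      using nQ by (intro card_mono) auto
    also have "\<dots> \<le> k\<^sup>2 * card {q. q < Q \<and> planted l q} + 2 * k * Q"
      using k0 by (intro card_fixed_positions_le) simp
    finally have "real (card {i. i < n \<and> i \<in> fixed_positions l k})
        \<le> real (k\<^sup>2 * card {q. q < Q \<and> planted l q} + 2 * k * Q)" by (rule of_nat_mono)
    also have "\<dots> = K * real (card {q. q < Q \<and> planted l q}) + 2 * real k * real Q"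
      by (simp add: K_def)
    also have "\<dots> \<le> K * (\<delta> * real Q + C) + (\<delta> * real k) * real k * real Q"
      using C[of Q] K k0 k\<delta> by (intro add_mono mult_left_mono mult_right_mono) auto
    also have "\<dots> = 2 * \<delta> * (real Q * K) + K * C" by (simp add: K_def power2_eq_square algebra_simps)
    also have "\<dots> \<le> 2 * \<delta> * (real n + K) + K * C" using QK \<delta> by simp
    finally have fixed: "real (card {i. i < n \<and> i \<in> fixed_positions l k})
        \<le> 2 * \<delta> * (real n + K) + K * C" .
    have "{..<n} = {i. i < n \<and> i \<in> fixed_positions l k} \<union> {i. i < n \<and> i \<notin> fixed_positions l k}"
      by auto
    then have "n = card ({i. i < n \<and> i \<in> fixed_positions l k} \<union> {i. i < n \<and> i \<notin> fixed_positions l k})"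
      by (metis card_lessThan)
    also have "\<dots> = card {i. i < n \<and> i \<in> fixed_positions l k}
        + card {i. i < n \<and> i \<notin> fixed_positions l k}"
      by (rule card_Un_disjoint) auto
    finally have "real n = real (card {i. i < n \<and> i \<in> fixed_positions l k})
        + real (card {i. i < n \<and> i \<notin> fixed_positions l k})" by linarith
    moreover have "\<gamma> * real n = real n - 2 * \<delta> * real n"
      by (simp add: \<delta>_def field_simps)
    moreover have "2 * \<delta> * (real n + K) = 2 * \<delta> * real n + 2 * \<delta> * K"
      by (rule distrib_left)
    ultimately show ?thesis using fixed by linarith
  qed
  then show ?thesis by (rule that)
qed

text \<open>The ones at multiples of \<open>k\<close> behind the initial zeros of an unplanted block
  keep the expansion of \<open>x\<close> nonterminating.\<close>

definition marker_digit :: "(nat \<Rightarrow> nat) \<Rightarrow> nat \<Rightarrow> nat \<Rightarrow> nat" where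
  "marker_digit l k i = (if planted l (i div k\<^sup>2) \<or> k \<le> i mod k\<^sup>2 then 1 else 0)"

section \<open>Longest common substrings\<close>

text \<open>The premise is conditional because a planted run may have length 0, which is never a
  member of the set of lengths.\<close>

lemma le_longest_common_substring:
  assumes "1 \<le> L \<Longrightarrow> L \<in> common_substring_lengths b x y n"
  shows "L \<le> longest_common_substring b x y n"
proof (cases "L = 0")
  case False
  have "finite (common_substring_lengths b x y n)"
    by (rule finite_subset[of _ "{..n}"]) (auto simp: common_substring_lengths_def)
  with False assms show ?thesis by (auto simp: longest_common_substring_def)
qed simp

lemma longest_common_substring_le:
  assumes "\<And>L. L \<in> common_substring_lengths b x y n \<Longrightarrow> L \<le> m"
  shows "longest_common_substring b x y n \<le> m"
proof -
  have "finite (common_substring_lengths b x y n)"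
    by (rule finite_subset[of _ "{..n}"]) (auto simp: common_substring_lengths_def)
  then show ?thesis using assms by (auto simp: longest_common_substring_def)
qed

context
  fixes b k :: nat and l :: "nat \<Rightarrow> nat" and x y t t' :: real
  assumes l: "mono l" "\<And>j. (l j)\<^sup>2 \<le> j" and k: "k > 0"
    and x: "digits b x = fill b (fixed_positions l k) (marker_digit l k) t"
    and y: "digits b y = fill b (fixed_positions l k) (\<lambda>_. 1) t'"
begin

text \<open>The planted run starting at block \<open>s^2\<close> occupies the same places in
  \<open>x\<close> and \<open>y\<close>. Taking the square before the last one reached ensures that
  the whole run lies in the first \<open>n\<close> digits.\<close>

lemma longest_common_substring_lower:
  assumes s: "floor_sqrt (n div k\<^sup>2) = Suc s"
  shows "k\<^sup>2 * l s \<le> longest_common_substring b x y n"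
proof (rule le_longest_common_substring)
  assume pos: "1 \<le> k\<^sup>2 * l s"
  have ls: "l s \<le> s"
    using l(2)[of s] by (rule power2_nat_le_imp_le)
  have "(Suc s)\<^sup>2 \<le> n div k\<^sup>2"
    using floor_sqrt_power2_le[of "n div k\<^sup>2"] s by simp
  then have "(Suc s)\<^sup>2 * k\<^sup>2 \<le> n"
    by (meson mult_le_mono1 order_trans div_times_less_eq_dividend)
  moreover have "(s\<^sup>2 + l s) * k\<^sup>2 \<le> (Suc s)\<^sup>2 * k\<^sup>2"
    using ls by (intro mult_le_mono1) (simp add: power2_eq_square)
  ultimately have fits: "s\<^sup>2 * k\<^sup>2 + k\<^sup>2 * l s \<le> n" by (simp add: algebra_simps)
  have "planted l ((s\<^sup>2 * k\<^sup>2 + a) div k\<^sup>2)" if a: "a < k\<^sup>2 * l s" for a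
  proof -
    have "a div k\<^sup>2 < l s" using a k by (simp add: less_mult_imp_div_less mult.commute)
    moreover from this have "floor_sqrt (s\<^sup>2 + a div k\<^sup>2) = s"
      using ls by (intro floor_sqrt_unique) (simp_all add: power2_eq_square)
    ultimately show ?thesis using k by (simp add: planted_def)
  qed
  then have "\<forall>a<k\<^sup>2 * l s. digits b x (s\<^sup>2 * k\<^sup>2 + a) = digits b y (s\<^sup>2 * k\<^sup>2 + a)"
    by (simp add: x y fill_def fixed_positions_def marker_digit_def)
  with pos fits show "k\<^sup>2 * l s \<in> common_substring_lengths b x y n"
    unfolding common_substring_lengths_def by blast
qed

text \<open>Every unplanted block of \<open>x\<close> starts with \<open>k\<close> zeros, whereas \<open>y\<close> never has \<open>k\<close> zeros
  in a row; so a common substring can contain only planted blocks of \<open>x\<close>.\<close>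

lemma longest_common_substring_upper:
  "longest_common_substring b x y n \<le> k\<^sup>2 * (l (floor_sqrt (n div k\<^sup>2)) + 2)"
proof (rule longest_common_substring_le, rule ccontr)
  define m where "m = l (floor_sqrt (n div k\<^sup>2))"
  fix L assume "L \<in> common_substring_lengths b x y n"
    and "\<not> L \<le> k\<^sup>2 * (l (floor_sqrt (n div k\<^sup>2)) + 2)"
  then obtain i j where L: "(m + 2) * k\<^sup>2 < L" and fits: "i + L \<le> n"
    and same: "\<And>a. a < L \<Longrightarrow> digits b x (i + a) = digits b y (j + a)"
    by (auto simp: common_substring_lengths_def m_def mult.commute)
  \<comment> \<open>Block \<open>q\<close> is the first one certain to start inside the substring of
    \<open>x\<close>. The two extra blocks in the length leave room for all of the blocks
    \<open>q\<close> to \<open>q + m\<close>.\<close>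
  define q where "q = Suc (i div k\<^sup>2)"
  have q: "i \<le> q * k\<^sup>2" "q * k\<^sup>2 \<le> i + k\<^sup>2"
    using dividend_less_div_times[of "k\<^sup>2" i] k by (simp_all add: q_def)
  have fin: "(q + m + 1) * k\<^sup>2 \<le> i + L" using q L by (simp add: algebra_simps)
  have "planted l (q + c)" if c: "c \<le> m" for c
  proof (rule ccontr)
    assume np: "\<not> planted l (q + c)"
    define a where "a = (q + c) * k\<^sup>2 - i"
    have a: "i + a = (q + c) * k\<^sup>2" using q by (simp add: a_def algebra_simps)
    \<comment> \<open>From \<open>j + a\<close> it takes \<open>r\<close> steps to the next multiple
      of \<open>k\<close>, where \<open>y\<close> has a one. As \<open>r < k\<close>, the matching
      place in \<open>x\<close> is still among the initial zeros of its block.\<close>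
    define r where "r = (k - (j + a) mod k) mod k"
    have r: "r < k" using k by (simp add: r_def)
    have "k dvd j + a + r"
    proof -
      have "(j + a + r) mod k = ((j + a) mod k + (k - (j + a) mod k)) mod k"
        unfolding r_def by (metis mod_add_eq mod_mod_trivial)
      also have "\<dots> = 0" using k by (simp add: less_imp_le)
      finally show ?thesis by presburger
    qed
    then have one: "digits b y (j + (a + r)) = 1"
      by (simp add: y fill_def fixed_positions_def add.assoc)
    have k2: "k \<le> k\<^sup>2" by (simp add: power2_eq_square)
    then have "i + (a + r) < (q + c + 1) * k\<^sup>2" using a r by (simp add: algebra_simps)
    also have "\<dots> \<le> (q + m + 1) * k\<^sup>2" using c by (intro mult_le_mono1) simp
    finally have "a + r < L" using fin by simp
    moreover have "(i + (a + r)) div k\<^sup>2 = q + c" "(i + (a + r)) mod k\<^sup>2 = r"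
      using r k2 k by (simp_all add: a flip: add.assoc)
    then have "digits b x (i + (a + r)) = 0"
      using np r by (simp add: x fill_def fixed_positions_def marker_digit_def)
    ultimately show False using same[of "a + r"] one by simp
  qed
  then have "m < l (floor_sqrt (q + m))" using l(2) by (intro planted_run_bound)
  also have "q + m \<le> n div k\<^sup>2"
    using order_trans[OF fin fits] k
    by (simp add: less_eq_div_iff_mult_less_eq)
  then have "l (floor_sqrt (q + m)) \<le> m"
    unfolding m_def by (intro monoD[OF l(1)] monoD[OF mono_floor_sqrt])
  finally show False by simp
qed

end

section \<open>Run lengths for a prescribed limit\<close>

text \<open>Up to bounded errors \<open>S n\<close> is \<open>M * l s\<close> with \<open>s\<close>
  near the root of \<open>n / M\<close>, so \<open>l\<close> has to grow like a suitable multiple of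
  \<open>ln s\<close>, or faster for an infinite limit. Quantifying over \<open>S\<close> lets one
  \<open>l\<close> serve all pairs of parameters.\<close>

lemma exists_run_lengths:
  fixes \<alpha> :: ereal
  assumes b: "2 \<le> b" and M: "0 < M" and \<alpha>: "0 \<le> \<alpha>"
  obtains l :: "nat \<Rightarrow> nat" where "mono l" "\<And>j. (l j)\<^sup>2 \<le> j"
    "\<And>S. (\<And>n s. floor_sqrt (n div M) = Suc s \<Longrightarrow> M * l s \<le> S n) \<Longrightarrow>
      (\<And>n. S n \<le> M * (l (floor_sqrt (n div M)) + 2)) \<Longrightarrow>
      (\<lambda>n. ereal (real (S n) / log (real b) (real n))) \<longlonglongrightarrow> \<alpha>"
proof -
  define s where "s = (\<lambda>n. floor_sqrt (n div M))"
  have s_le: "real (s n) \<le> sqrt (real n / real M)" for n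
  proof -
    have "real (n div M) \<le> real n / real M" by (rule of_nat_div_le_of_nat)
    then show ?thesis
      using floor_sqrt_bounds(1)[of "n div M"] unfolding s_def
      by (meson order_trans real_sqrt_le_mono)
  qed
  have s_ge: "sqrt (real n / real M) - 2 \<le> real (s n) - 1" for n
  proof -
    have "n div M < (Suc (s n))\<^sup>2" unfolding s_def by (rule Suc_floor_sqrt_power2_gt)
    then have "n < (Suc (s n))\<^sup>2 * M" using M by (simp add: div_less_iff_less_mult)
    then have "real n < real ((Suc (s n))\<^sup>2 * M)" by (rule iffD2[OF of_nat_less_iff])
    then have "real n / real M \<le> (real (Suc (s n)))\<^sup>2" using M by (simp add: field_simps)
    then have "sqrt (real n / real M) \<le> real (Suc (s n))" by (intro real_le_lsqrt) simp_all
    then show ?thesis by simp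
  qed
  have s_lim: "filterlim s at_top sequentially"
  proof -
    have "filterlim (\<lambda>n. sqrt (real n / real M) - 1) at_top sequentially"
      using M by real_asymp
    then have "filterlim (\<lambda>n. real (s n)) at_top sequentially"
      by (rule filterlim_at_top_mono) (use s_ge in \<open>auto intro!: always_eventually simp: algebra_simps\<close>)
    then show ?thesis by (simp add: filterlim_sequentially_iff_filterlim_real)
  qed
  have s_pos: "\<forall>\<^sub>F n in sequentially. s n \<ge> 1"
    using s_lim by (simp add: filterlim_at_top)
  have log_pos: "\<forall>\<^sub>F n in sequentially. 0 < log (real b) (real n)"
    using eventually_gt_at_top[of 1] by eventually_elim (use b in simp)
  show ?thesis
  proof (cases "\<alpha> = \<infinity>")
    case True
    show ?thesis
    \<comment> \<open>This is the largest \<open>l\<close> allowed by the constraint. It makes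
      \<open>S n\<close> at least of order \<open>n^(1/4)\<close>, which outgrows the
      logarithm.\<close>
    proof (rule that[of floor_sqrt])
      fix S :: "nat \<Rightarrow> nat"
      assume lower: "\<And>n s. floor_sqrt (n div M) = Suc s \<Longrightarrow> M * floor_sqrt s \<le> S n"
      have "filterlim (\<lambda>n. (sqrt (sqrt (real n / real M) - 2) - 1) / log (real b) (real n))
          at_top sequentially"
        using M b by real_asymp
      then have "filterlim (\<lambda>n. real (S n) / log (real b) (real n)) at_top sequentially"
      proof (rule filterlim_at_top_mono)
        show "\<forall>\<^sub>F n in sequentially.
          (sqrt (sqrt (real n / real M) - 2) - 1) / log (real b) (real n)
            \<le> real (S n) / log (real b) (real n)"
          using log_pos s_pos
        proof eventually_elim
          case (elim n)
          have "sqrt (sqrt (real n / real M) - 2) \<le> sqrt (real (s n - 1))"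
            using s_ge[of n] elim by (simp add: of_nat_diff)
          then have "sqrt (sqrt (real n / real M) - 2) - 1 \<le> real (floor_sqrt (s n - 1))"
            using floor_sqrt_bounds(2)[of "s n - 1"] by linarith
          also have "\<dots> \<le> real (M * floor_sqrt (s n - 1))" using M by (intro of_nat_mono) simp
          also have "\<dots> \<le> real (S n)"
            using lower[of n "s n - 1"] elim by (intro of_nat_mono) (simp add: s_def)
          finally show ?case using elim by (intro divide_right_mono) auto
        qed
      qed
      then show "(\<lambda>n. ereal (real (S n) / log (real b) (real n))) \<longlonglongrightarrow> \<alpha>"
        unfolding True by (simp add: tendsto_PInfty_eq_at_top)
    qed (use floor_sqrt_power2_le mono_floor_sqrt in auto)
  next
    case False
    then obtain a where a: "\<alpha> = ereal a" "0 \<le> a" using \<alpha> by (cases \<alpha>) auto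
    \<comment> \<open>Since \<open>ln s\<close> is about half of \<open>ln n\<close>, the factor 2
      makes \<open>M * c * ln s\<close> asymptotic to \<open>a\<close> times the
      base-\<open>b\<close> logarithm of \<open>n\<close> when \<open>a > 0\<close>.\<close>
    define c where "c = 2 * a / (real M * ln (real b))"
    have c: "c \<ge> 0" using a b M by (simp add: c_def)
    \<comment> \<open>The minimum enforces the constraint for every \<open>j\<close>, and for large
      \<open>j\<close> it costs at most the rounding error. The shift by 1 keeps the logarithm
      nonnegative at \<open>j = 0\<close>.\<close>
    define l where "l = (\<lambda>j. min (floor_sqrt j) (nat \<lfloor>c * ln (real j + 1)\<rfloor>))"
    have l_le: "real (l j) \<le> c * ln (real j + 1)" for j
    proof -
      have "real (l j) \<le> real (nat \<lfloor>c * ln (real j + 1)\<rfloor>)" by (simp add: l_def)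
      also have "\<dots> \<le> c * ln (real j + 1)" using c by (intro of_nat_floor) simp
      finally show ?thesis .
    qed
    have "\<forall>\<^sub>F j in sequentially. c * ln (real j + 1) \<le> sqrt (real j)"
      by real_asymp
    then have l_ge: "\<forall>\<^sub>F j in sequentially. c * ln (real j + 1) - 1 \<le> real (l j)"
    proof eventually_elim
      case (elim j)
      have "c * ln (real j + 1) - 1 \<le> real (floor_sqrt j)"
        using floor_sqrt_bounds(2)[of j] elim by linarith
      moreover have "c * ln (real j + 1) - 1 \<le> real (nat \<lfloor>c * ln (real j + 1)\<rfloor>)"
        by linarith
      ultimately show ?case by (simp add: l_def min_def)
    qed
    show ?thesis
    proof (rule that[of l])
      show "mono l"
        unfolding l_def using c
        by (intro monoI min.mono monoD[OF mono_floor_sqrt] nat_mono floor_mono mult_left_mono) auto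
      show "(l j)\<^sup>2 \<le> j" for j
      proof -
        have "(l j)\<^sup>2 \<le> (floor_sqrt j)\<^sup>2" by (intro power_mono) (simp_all add: l_def)
        then show ?thesis using floor_sqrt_power2_le order_trans by blast
      qed
      fix S :: "nat \<Rightarrow> nat"
      assume lower: "\<And>n s. floor_sqrt (n div M) = Suc s \<Longrightarrow> M * l s \<le> S n"
        and upper: "\<And>n. S n \<le> M * (l (floor_sqrt (n div M)) + 2)"
      have "((\<lambda>n. real (S n) / log (real b) (real n)) \<longlongrightarrow> a) sequentially"
      proof (rule tendsto_sandwich)
        have "((\<lambda>n. real M * (c * ln (sqrt (real n / real M) - 1) - 1) / log (real b) (real n))
            \<longlongrightarrow> real M * (c * (1 / 2)) * ln (real b)) sequentially"
          using M b by real_asymp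
        moreover have eq: "real M * (c * (1 / 2)) * ln (real b) = a"
          using M b by (simp add: c_def)
        ultimately show "((\<lambda>n. real M * (c * ln (sqrt (real n / real M) - 1) - 1)
            / log (real b) (real n)) \<longlongrightarrow> a) sequentially" by simp
        have "((\<lambda>n. real M * (c * ln (sqrt (real n / real M) + 1) + 2) / log (real b) (real n))
            \<longlongrightarrow> real M * (c * (1 / 2)) * ln (real b)) sequentially"
          using M b by real_asymp
        with eq show "((\<lambda>n. real M * (c * ln (sqrt (real n / real M) + 1) + 2)
            / log (real b) (real n)) \<longlongrightarrow> a) sequentially" by simp
        have "filterlim (\<lambda>n. s n - 1) at_top sequentially"
          using filterlim_compose[OF filterlim_minus_const_nat_at_top s_lim] .
        then have l_ge': "\<forall>\<^sub>F n in sequentially. c * ln (real (s n - 1) + 1) - 1 \<le> real (l (s n - 1))"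
          using l_ge by (rule eventually_compose_filterlim[rotated])
        have big: "\<forall>\<^sub>F n in sequentially. sqrt (real n / real M) - 1 > 0"
          using M by real_asymp
        show "\<forall>\<^sub>F n in sequentially.
          real M * (c * ln (sqrt (real n / real M) - 1) - 1) / log (real b) (real n)
            \<le> real (S n) / log (real b) (real n)"
          using log_pos s_pos l_ge' big
        proof eventually_elim
          case (elim n)
          have "c * ln (sqrt (real n / real M) - 1) \<le> c * ln (real (s n - 1) + 1)"
            using s_ge[of n] elim c by (intro mult_left_mono) (simp_all add: of_nat_diff)
          then have "real M * (c * ln (sqrt (real n / real M) - 1) - 1) \<le> real M * real (l (s n - 1))"
            using elim by (intro mult_left_mono) auto
          also have "\<dots> \<le> real (S n)"
            using lower[of n "s n - 1"] elim
            by (metis One_nat_def Suc_pred less_eq_Suc_le of_nat_le_iff of_nat_mult s_def)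
          finally show ?case using elim by (intro divide_right_mono) auto
        qed
        show "\<forall>\<^sub>F n in sequentially. real (S n) / log (real b) (real n)
            \<le> real M * (c * ln (sqrt (real n / real M) + 1) + 2) / log (real b) (real n)"
          using log_pos
        proof eventually_elim
          case (elim n)
          have "real (S n) \<le> real (M * (l (s n) + 2))"
            unfolding s_def by (intro of_nat_mono upper)
          also have "\<dots> = real M * (real (l (s n)) + 2)" by (simp add: distrib_left)
          also have "\<dots> \<le> real M * (c * ln (sqrt (real n / real M) + 1) + 2)"
          proof (intro mult_left_mono add_mono)
            have "c * ln (real (s n) + 1) \<le> c * ln (sqrt (real n / real M) + 1)"
              using s_le[of n] c by (intro mult_left_mono) simp_all
            then show "real (l (s n)) \<le> c * ln (sqrt (real n / real M) + 1)"
              using l_le[of "s n"] by linarith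
          qed auto
          finally show ?case using elim by (intro divide_right_mono) auto
        qed
      qed
      then show "(\<lambda>n. ereal (real (S n) / log (real b) (real n))) \<longlonglongrightarrow> \<alpha>"
        by (simp add: a)
    qed
  qed
qed

section \<open>Assembly of the dimension formula\<close>

text \<open>The place at offset \<open>k\<close> in each block is a multiple of \<open>k\<close>,
  hence fixed. It lies behind the initial zeros because \<open>k \<ge> 2\<close> gives
  \<open>k < k^2\<close>.\<close>

lemma infinite_nonzero_fill:
  assumes k: "k \<ge> 2" and u: "\<And>i. k dvd i \<Longrightarrow> k \<le> i mod k\<^sup>2 \<Longrightarrow> u i \<noteq> 0"
  shows "infinite {i. fill b (fixed_positions l k) u t i \<noteq> 0}"
  unfolding infinite_nat_iff_unbounded
proof
  fix m
  have "k < k\<^sup>2" using k by (simp add: power2_eq_square)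
  then have "(k + Suc m * k\<^sup>2) mod k\<^sup>2 = k" by (simp only: mod_mult_self1 mod_less)
  moreover have "k dvd k + Suc m * k\<^sup>2" by (simp add: power2_eq_square)
  ultimately have "fill b (fixed_positions l k) u t (k + Suc m * k\<^sup>2) \<noteq> 0"
    using u by (simp add: fill_def fixed_positions_def)
  moreover have "Suc m * 1 \<le> Suc m * k\<^sup>2" using k by (intro mult_le_mono2) simp
  then have "m < k + Suc m * k\<^sup>2" by simp
  ultimately show "\<exists>n>m. n \<in> {i. fill b (fixed_positions l k) u t i \<noteq> 0}" by blast
qed

theorem theorem1p1:
  fixes b :: nat and \<alpha> :: ereal
  assumes "2 \<le> b" and "0 \<le> \<alpha>"
  shows "hausdorff_dim (level_set b \<alpha>) = 2"
proof (rule antisym)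
  note b = \<open>2 \<le> b\<close>
  show "hausdorff_dim (level_set b \<alpha>) \<le> 2"
    by (rule hausdorff_dim_unit_square_le) (auto simp: level_set_def)
  have lower: "ennreal (2 * \<gamma>) \<le> hausdorff_dim (level_set b \<alpha>)" if \<gamma>: "0 < \<gamma>" "\<gamma> < 1" for \<gamma>
  proof -
    define k where "k = max 2 (nat \<lceil>4 / (1 - \<gamma>)\<rceil>)"
    have k: "2 \<le> k" "4 / (1 - \<gamma>) \<le> real k"
      unfolding k_def by (simp, linarith)
    then have k0: "0 < k" by simp
    show ?thesis
    proof (rule exists_run_lengths[OF b zero_less_power[OF k0, of 2] \<open>0 \<le> \<alpha>\<close>])
      fix l :: "nat \<Rightarrow> nat"
      assume l: "mono l" "\<And>j. (l j)\<^sup>2 \<le> j"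
        and lim: "\<And>S. (\<And>n s. floor_sqrt (n div k\<^sup>2) = Suc s \<Longrightarrow> k\<^sup>2 * l s \<le> S n) \<Longrightarrow>
          (\<And>n. S n \<le> k\<^sup>2 * (l (floor_sqrt (n div k\<^sup>2)) + 2)) \<Longrightarrow>
          (\<lambda>n. ereal (real (S n) / log (real b) (real n))) \<longlonglongrightarrow> \<alpha>"
      define F where "F = fixed_positions l k"
      obtain C where C: "\<And>n. \<gamma> * real n - C \<le> real (card {i. i < n \<and> i \<notin> F})"
        using free_positions_dense[OF l \<gamma>(2) k(2)] unfolding F_def by blast
      define X where "X = (\<lambda>t. expansion_value b (fill b F (marker_digit l k) t))"
      define Y where "Y = (\<lambda>t. expansion_value b (fill b F (\<lambda>_. 1) t))"
      define K where "K = real b powr (C + \<gamma> * (real k + 1))"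
      have u: "marker_digit l k i < b" for i using b by (simp add: marker_digit_def)
      have multiples: "k dvd i \<Longrightarrow> i \<in> F" for i by (simp add: F_def fixed_positions_def)
      have HX: "\<bar>t - t'\<bar> \<le> K * \<bar>X t - X t'\<bar> powr \<gamma>"
        and HY: "\<bar>t - t'\<bar> \<le> K * \<bar>Y t - Y t'\<bar> powr \<gamma>"
        if "t \<in> {0..<1}" "t' \<in> {0..<1}" for t t'
        unfolding X_def Y_def K_def
        by (rule fill_inverse_Hoelder[OF b _ k0 _ \<gamma>(1) C that]; use b u multiples in simp)+
      \<comment> \<open>Each coordinate difference is at most \<open>K\<close> times a power of the
        full distance, and adding the two gives the factor 2.\<close>
      have "dist p q \<le> (2 * K) * dist (map_prod X Y p) (map_prod X Y q) powr \<gamma>"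
        if pq: "p \<in> {0..<1} \<times> {0..<1}" "q \<in> {0..<1} \<times> {0..<1}" for p q
      proof -
        let ?D = "dist (map_prod X Y p) (map_prod X Y q)"
        have "dist p q \<le> \<bar>fst p - fst q\<bar> + \<bar>snd p - snd q\<bar>"
          unfolding dist_prod_def dist_real_def
          using sqrt_sum_squares_le_sum_abs[of "\<bar>fst p - fst q\<bar>"] by simp
        also have "\<dots> \<le> K * \<bar>X (fst p) - X (fst q)\<bar> powr \<gamma> + K * \<bar>Y (snd p) - Y (snd q)\<bar> powr \<gamma>"
          using pq by (intro add_mono HX HY) auto
        also have "\<dots> \<le> K * ?D powr \<gamma> + K * ?D powr \<gamma>"
          using dist_fst_le[of "map_prod X Y p" "map_prod X Y q"]
            dist_snd_le[of "map_prod X Y p" "map_prod X Y q"] \<gamma>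
          by (intro add_mono mult_left_mono powr_mono2) (simp_all add: K_def dist_real_def)
        finally show ?thesis by simp
      qed
      moreover have "map_prod X Y ` ({0..<1} \<times> {0..<1}) \<subseteq> level_set b \<alpha>"
      proof (rule image_subsetI)
        fix p :: "real \<times> real"
        obtain t t' where p: "p = (t, t')" by (cases p)
        have d: "\<And>i. fill b F (marker_digit l k) t i < b" "\<And>i. fill b F (\<lambda>_. 1) t' i < b"
          using fill_less[OF b] u b by simp_all
        have inf: "infinite {i. fill b F (marker_digit l k) t i \<noteq> 0}"
          "infinite {i. fill b F (\<lambda>_. 1) t' i \<noteq> 0}"
          unfolding F_def using k(1)
          by (intro infinite_nonzero_fill; simp add: marker_digit_def)+
        have dig: "digits b (X t) = fill b (fixed_positions l k) (marker_digit l k) t"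
          "digits b (Y t') = fill b (fixed_positions l k) (\<lambda>_. 1) t'"
          using digits_expansion_value[OF b d(1) inf(1)] digits_expansion_value[OF b d(2) inf(2)]
          by (simp_all add: X_def Y_def F_def)
        have "X t \<in> {0<..1}" "Y t' \<in> {0<..1}"
          unfolding X_def Y_def
          using expansion_value_in_unit_interval[OF b d(1) inf(1)]
            expansion_value_in_unit_interval[OF b d(2) inf(2)] by blast+
        moreover have "(\<lambda>n. ereal (real (longest_common_substring b (X t) (Y t') n)
            / log (real b) (real n))) \<longlonglongrightarrow> \<alpha>"
          by (rule lim)
            (rule longest_common_substring_lower[OF l k0 dig]
              longest_common_substring_upper[OF l k0 dig], assumption?)+
        ultimately show "map_prod X Y p \<in> level_set b \<alpha>" by (simp add: level_set_def p)
      qed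
      ultimately show ?thesis
        using b \<gamma> by (intro hausdorff_dim_ge_of_inverse_Hoelder[where C = "2 * K" and \<phi> = "map_prod X Y"])
          (auto simp: K_def)
    qed
  qed
  show "2 \<le> hausdorff_dim (level_set b \<alpha>)"
  proof (rule ennreal_le_epsilon)
    fix e :: real assume e: "e > 0"
    \<comment> \<open>The second argument gives \<open>2 * \<gamma> + e \<ge> 2\<close>, and the
      first keeps \<open>\<gamma>\<close> positive when \<open>e\<close> is large.\<close>
    define \<gamma> where "\<gamma> = max (1 / 2) (1 - e / 2)"
    have "(2::ennreal) = ennreal 2" by simp
    also have "\<dots> \<le> ennreal (2 * \<gamma> + e)" by (rule ennreal_leI) (simp add: \<gamma>_def max_def)
    also have "\<dots> = ennreal (2 * \<gamma>) + ennreal e" using e by (simp add: ennreal_plus \<gamma>_def)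
    also have "\<dots> \<le> hausdorff_dim (level_set b \<alpha>) + ennreal e"
      using e by (intro add_right_mono lower) (auto simp: \<gamma>_def)
    finally show "2 \<le> hausdorff_dim (level_set b \<alpha>) + ennreal e" .
  qed
qed

end
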